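(* Let $\Gamma$ be a finite simple undirected vertex-transitive graph that is neither complete nor cocomplete. Then $\Gamma$ is isomorphic to a non-trivial wreath product of graphs if and only if $\Gamma$ is not prime.
   Context: All graphs are undirected, simple (no loops) and finite. A graph is complete if any two distinct vertices are adjacent, and cocomplete if no two vertices are adjacent. A graph $\Gamma$ is vertex-transitive if some group acts on $V(\Gamma)$ transitively, with every group element preserving adjacency. The wreath (lexicographic) product $\Gamma\cdot\Delta$ has vertex set $V(\Gamma)\times V(\Delta)$, with $(x,y)$ adjacent to $(x',y')$ iff either $xx'$ is an edge of $\Gamma$, or $x=x'$ and $yy'$ is an edge of $\Delta$. It is non-trivial if both $\Gamma$ and $\Delta$ have at least two vertices. A non-empty set $H\subseteq V(\Gamma)$ is homogeneous if every vertex $x\notin H$ is adjacent either to all elements of $H$ or to none of them; it is non-trivial if $2\le |H|<|V(\Gamma)|$. A graph is prime if it has no non-trivial homogeneous set. *)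

theory Defs
  imports
    "Graph_Theory.Pair_Digraph"
    "Graph_Theory.Digraph_Isomorphism"
    "HOL-Algebra.Group_Action"
begin

text \<open>
  A finite simple undirected graph is a \<^locale>\<open>pair_graph\<close>: a finite vertex set with a symmetric,
  irreflexive set of arcs on it, so that \<open>x\<close> and \<open>y\<close> are adjacent iff \<open>(x, y) \<in> parcs G\<close>.
\<close>

definition complete_graph :: "'a pair_pre_digraph \<Rightarrow> bool" where
  "complete_graph G \<longleftrightarrow> (\<forall>x\<in>pverts G. \<forall>y\<in>pverts G. x \<noteq> y \<longrightarrow> (x, y) \<in> parcs G)"

definition cocomplete_graph :: "'a pair_pre_digraph \<Rightarrow> bool" where
  "cocomplete_graph G \<longleftrightarrow> (\<forall>x\<in>pverts G. \<forall>y\<in>pverts G. (x, y) \<notin> parcs G)"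

text \<open>
  The type of the elements of the acting group is fixed here, because HOL cannot quantify over
  types. This is no restriction: see \<open>vertex_transitiveI\<close> below.
\<close>

definition vertex_transitive :: "'a pair_pre_digraph \<Rightarrow> bool" where
  "vertex_transitive G \<longleftrightarrow>
    (\<exists>(K :: ('a \<Rightarrow> 'a) monoid) \<phi>. transitive_action K (pverts G) \<phi> \<and>
      (\<forall>g\<in>carrier K. \<forall>x y. (x, y) \<in> parcs G \<longrightarrow> (\<phi> g x, \<phi> g y) \<in> parcs G))"

definition wreath_product ::
    "'a pair_pre_digraph \<Rightarrow> 'b pair_pre_digraph \<Rightarrow> ('a \<times> 'b) pair_pre_digraph" where
  "wreath_product G D = \<lparr>
    pverts = pverts G \<times> pverts D,
    parcs = {((x, y), (x', y')) | x y x' y'.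
      (x, y) \<in> pverts G \<times> pverts D \<and> (x', y') \<in> pverts G \<times> pverts D \<and>
      ((x, x') \<in> parcs G \<or> x = x' \<and> (y, y') \<in> parcs D)} \<rparr>"

text \<open>
  The factors have vertices in \<^typ>\<open>nat\<close>, which every finite graph has up to isomorphism; factors
  over arbitrary types give the same notion, see \<open>iso_nontrivial_wreath_productI\<close> below.
\<close>

definition iso_nontrivial_wreath_product :: "'a pair_pre_digraph \<Rightarrow> bool" where
  "iso_nontrivial_wreath_product G \<longleftrightarrow>
    (\<exists>(A :: nat pair_pre_digraph) (B :: nat pair_pre_digraph).
      pair_graph A \<and> pair_graph B \<and> 2 \<le> card (pverts A) \<and> 2 \<le> card (pverts B) \<and>
      digraph_iso (with_proj G) (with_proj (wreath_product A B)))"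

definition homogeneous :: "'a pair_pre_digraph \<Rightarrow> 'a set \<Rightarrow> bool" where
  "homogeneous G H \<longleftrightarrow> H \<noteq> {} \<and> H \<subseteq> pverts G \<and>
    (\<forall>x\<in>pverts G - H. (\<forall>h\<in>H. (x, h) \<in> parcs G) \<or> (\<forall>h\<in>H. (x, h) \<notin> parcs G))"

definition prime_graph :: "'a pair_pre_digraph \<Rightarrow> bool" where
  "prime_graph G \<longleftrightarrow> \<not> (\<exists>H. homogeneous G H \<and> 2 \<le> card H \<and> card H < card (pverts G))"

lemma pair_graph_wreath_product:
  assumes "pair_graph A" "pair_graph B"
  shows "pair_graph (wreath_product A B)"
proof -
  interpret A: pair_graph A by fact
  interpret B: pair_graph B by fact
  have fin: "finite (parcs (wreath_product A B))"
    by (rule finite_subset[of _ "(pverts A \<times> pverts B) \<times> (pverts A \<times> pverts B)"])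
      (auto simp: wreath_product_def)
  have symA: "(y, x) \<in> parcs A" if "(x, y) \<in> parcs A" for x y
    using that A.pair_sym_arcs by (auto simp: symmetric_def sym_def)
  have symB: "(y, x) \<in> parcs B" if "(x, y) \<in> parcs B" for x y
    using that B.pair_sym_arcs by (auto simp: symmetric_def sym_def)
  show ?thesis
    by unfold_locales
      (use fin symA symB A.pair_no_loops B.pair_no_loops in
        \<open>fastforce simp: wreath_product_def symmetric_def sym_def\<close>)+
qed

lemma digraph_iso_with_proj_iff:
  assumes "pair_wf_digraph G"
  shows "digraph_iso (with_proj G) (with_proj H) \<longleftrightarrow>
    (\<exists>f. bij_betw f (pverts G) (pverts H) \<and> parcs H = map_prod f f ` parcs G)"
    (is "?L \<longleftrightarrow> ?R")
proof
  interpret pair_wf_digraph G by fact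
  assume ?L
  then obtain h where h: "pre_digraph.digraph_isomorphism (with_proj G) h"
      and H: "with_proj H = app_iso h (with_proj G)"
    by (auto simp: digraph_iso_def)
  have V: "pverts H = iso_verts h ` pverts G" and A: "parcs H = iso_arcs h ` parcs G"
    and t: "iso_tail h = fst" and hd: "iso_head h = snd"
    using H by (auto simp: with_proj_def app_iso_def)
  have "iso_arcs h e = map_prod (iso_verts h) (iso_verts h) e" if "e \<in> parcs G" for e
    using h that t hd
    by (cases e) (auto simp: pre_digraph.digraph_isomorphism_def prod_eq_iff)
  then have "parcs H = map_prod (iso_verts h) (iso_verts h) ` parcs G"
    unfolding A by (rule image_cong[OF refl])
  moreover have "bij_betw (iso_verts h) (pverts G) (pverts H)"
    using h V by (auto simp: pre_digraph.digraph_isomorphism_def bij_betw_def)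
  ultimately show ?R by blast
next
  interpret pair_wf_digraph G by fact
  assume ?R
  then obtain f where f: "bij_betw f (pverts G) (pverts H)" "parcs H = map_prod f f ` parcs G"
    by blast
  have "parcs G \<subseteq> pverts G \<times> pverts G"
    using in_arcsD1 in_arcsD2 by auto
  then have "inj_on (map_prod f f) (parcs G)"
    using f(1) by (auto simp: bij_betw_def intro: inj_on_subset[OF map_prod_inj_on])
  then have "pre_digraph.digraph_isomorphism (with_proj G)
      \<lparr>iso_verts = f, iso_arcs = map_prod f f, iso_head = snd, iso_tail = fst\<rparr>"
    using f(1) wf_digraph by (auto simp: pre_digraph.digraph_isomorphism_def bij_betw_def)
  moreover have "with_proj H = app_iso
      \<lparr>iso_verts = f, iso_arcs = map_prod f f, iso_head = snd, iso_tail = fst\<rparr> (with_proj G)"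
    using f by (auto simp: with_proj_def app_iso_def bij_betw_def)
  ultimately show ?L by (auto simp: digraph_iso_def)
qed

lemma vertex_transitiveI:
  fixes K :: "('g, 'm) monoid_scheme"
  assumes "transitive_action K (pverts G) \<phi>"
    and pres: "\<forall>g\<in>carrier K. \<forall>x y. (x, y) \<in> parcs G \<longrightarrow> (\<phi> g x, \<phi> g y) \<in> parcs G"
  shows "vertex_transitive G"
proof -
  interpret transitive_action K "pverts G" \<phi> by fact
  interpret hom: group_hom K "BijGroup (pverts G)" \<phi> by (rule group_hom)
  let ?K = "(BijGroup (pverts G))\<lparr>carrier := \<phi> ` carrier K\<rparr>"
  have sub: "subgroup (\<phi> ` carrier K) (BijGroup (pverts G))"
    by (rule hom.img_is_subgroup)
  have "group ?K"
    using sub by (rule subgroup.subgroup_is_group) (rule group_BijGroup)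
  moreover have "(\<lambda>f. f) \<in> hom ?K (BijGroup (pverts G))"
    using subgroup.subset[OF sub] by (auto simp: hom_def)
  ultimately have "group_action ?K (pverts G) (\<lambda>f. f)"
    by (simp add: group_action_def group_hom_def group_hom_axioms_def group_BijGroup)
  then have "transitive_action ?K (pverts G) (\<lambda>f. f)"
    using unique_orbit by (auto simp: transitive_action_def transitive_action_axioms_def)
  moreover have "\<forall>g\<in>carrier ?K. \<forall>x y. (x, y) \<in> parcs G \<longrightarrow> (g x, g y) \<in> parcs G"
    using pres by auto
  ultimately show ?thesis
    unfolding vertex_transitive_def by blast
qed

lemma pair_graph_iso_nat:
  assumes "pair_graph (A :: 'a pair_pre_digraph)"
  obtains A' :: "nat pair_pre_digraph" and f
  where "pair_graph A'" "bij_betw f (pverts A) (pverts A')" "parcs A' = map_prod f f ` parcs A"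
proof -
  interpret pair_graph A by fact
  obtain f :: "'a \<Rightarrow> nat" where f: "inj_on f (pverts A)"
    using finite_imp_inj_to_nat_seg[OF pair_finite_verts] by blast
  define A' where "A' = \<lparr>pverts = f ` pverts A, parcs = map_prod f f ` parcs A\<rparr>"
  have "pair_graph A'"
  proof unfold_locales
    fix e assume "e \<in> parcs A'"
    then obtain u v where uv: "(u, v) \<in> parcs A" "e = (f u, f v)"
      by (auto simp: A'_def)
    then show "fst e \<in> pverts A'" "snd e \<in> pverts A'"
      by (auto simp: A'_def dest: in_arcsD1 in_arcsD2)
    have "u \<noteq> v" using pair_no_loops[OF uv(1)] by simp
    then show "fst e \<noteq> snd e"
      using uv f by (auto dest: inj_onD in_arcsD1 in_arcsD2)
  next
    show "symmetric (with_proj A')"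
      using pair_sym_arcs
      by (simp add: A'_def symmetric_def sym_def) (force simp: image_iff)
  qed (auto simp: A'_def)
  then show ?thesis
    by (rule that[of A' f]) (use f in \<open>auto simp: A'_def bij_betw_def\<close>)
qed

lemma iso_nontrivial_wreath_productI:
  fixes G :: "'a pair_pre_digraph" and A :: "'b pair_pre_digraph" and B :: "'c pair_pre_digraph"
  assumes G: "pair_graph G" and A: "pair_graph A" and B: "pair_graph B"
    and card: "2 \<le> card (pverts A)" "2 \<le> card (pverts B)"
    and iso: "digraph_iso (with_proj G) (with_proj (wreath_product A B))"
  shows "iso_nontrivial_wreath_product G"
proof -
  interpret A: pair_graph A by fact
  interpret B: pair_graph B by fact
  obtain A' :: "nat pair_pre_digraph" and f where A': "pair_graph A'"
    and f: "bij_betw f (pverts A) (pverts A')" and fA: "parcs A' = map_prod f f ` parcs A"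
    using pair_graph_iso_nat[OF A] by blast
  obtain B' :: "nat pair_pre_digraph" and g where B': "pair_graph B'"
    and g: "bij_betw g (pverts B) (pverts B')" and gB: "parcs B' = map_prod g g ` parcs B"
    using pair_graph_iso_nat[OF B] by blast
  let ?h = "map_prod f g"
  have injf: "f x = f y \<longleftrightarrow> x = y" if "x \<in> pverts A" "y \<in> pverts A" for x y
    using f that by (auto simp: bij_betw_def dest: inj_onD)
  have injg: "g x = g y \<longleftrightarrow> x = y" if "x \<in> pverts B" "y \<in> pverts B" for x y
    using g that by (auto simp: bij_betw_def dest: inj_onD)
  have VA: "pverts A' = f ` pverts A" and VB: "pverts B' = g ` pverts B"
    using f g by (auto simp: bij_betw_def)
  have eA: "(f x, f y) \<in> parcs A' \<longleftrightarrow> (x, y) \<in> parcs A" if "x \<in> pverts A" "y \<in> pverts A" for x y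
    using that unfolding fA by (auto simp: injf A.in_arcsD1 A.in_arcsD2 intro!: rev_image_eqI)
  have eB: "(g x, g y) \<in> parcs B' \<longleftrightarrow> (x, y) \<in> parcs B" if "x \<in> pverts B" "y \<in> pverts B" for x y
    using that unfolding gB by (auto simp: injg B.in_arcsD1 B.in_arcsD2 intro!: rev_image_eqI)
  have "bij_betw ?h (pverts (wreath_product A B)) (pverts (wreath_product A' B'))"
    using bij_betw_map_prod[OF f g] by (simp add: wreath_product_def)
  moreover have "parcs (wreath_product A' B') = map_prod ?h ?h ` parcs (wreath_product A B)"
  proof (intro equalityI subsetI)
    fix e assume "e \<in> parcs (wreath_product A' B')"
    then obtain x y x' y' where e: "e = ((f x, g y), (f x', g y'))"
      and V: "x \<in> pverts A" "x' \<in> pverts A" "y \<in> pverts B" "y' \<in> pverts B"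
      and adj: "(f x, f x') \<in> parcs A' \<or> f x = f x' \<and> (g y, g y') \<in> parcs B'"
      by (auto simp: wreath_product_def VA VB)
    have "((x, y), (x', y')) \<in> parcs (wreath_product A B)"
      using V adj by (auto simp: wreath_product_def eA eB injf)
    then show "e \<in> map_prod ?h ?h ` parcs (wreath_product A B)"
      by (rule rev_image_eqI) (simp add: e)
  next
    fix e assume "e \<in> map_prod ?h ?h ` parcs (wreath_product A B)"
    then show "e \<in> parcs (wreath_product A' B')"
      by (auto simp: wreath_product_def VA VB eA eB)
  qed
  ultimately have "digraph_iso (with_proj (wreath_product A B)) (with_proj (wreath_product A' B'))"
    using digraph_iso_with_proj_iff[of "wreath_product A B" "wreath_product A' B'"]
      pair_graph_wreath_product[OF A B]
    by (auto simp: pair_graph_def pair_digraph_def pair_fin_digraph_def)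
  then have "digraph_iso (with_proj G) (with_proj (wreath_product A' B'))"
    using iso by (rule digraph_iso_trans[rotated])
  moreover have "2 \<le> card (pverts A')" "2 \<le> card (pverts B')"
    using card bij_betw_same_card[OF f] bij_betw_same_card[OF g] by auto
  ultimately show ?thesis
    using A' B' unfolding iso_nontrivial_wreath_product_def by blast
qed

end

theory Submission
  imports Defs
begin

text \<open>
  For the hard direction it suffices to find an equivalence relation on the vertices, neither
  equality nor the full relation, that is invariant under automorphisms and whose classes are
  homogeneous: by transitivity the induced graphs on the classes are all isomorphic, so the graph
  is the wreath product of its quotient by one class. If there are two vertices with the same open,
  or the same closed, neighbourhood, that relation will do. Otherwise let \<open>k\<close> be the least size of a
  non-trivial homogeneous set, so that \<open>k > 2\<close>. Two distinct homogeneous sets of size \<open>k\<close> that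
  overlap have a homogeneous intersection and a homogeneous difference, which are both of size 1 by
  minimality, so \<open>k = 2\<close>. Hence the homogeneous sets of size \<open>k\<close> form an invariant partition.
\<close>

section \<open>Automorphisms and neighbourhoods\<close>

definition graph_aut :: "'a pair_pre_digraph \<Rightarrow> ('a \<Rightarrow> 'a) \<Rightarrow> bool" where
  "graph_aut G f \<longleftrightarrow> bij_betw f (pverts G) (pverts G) \<and>
    (\<forall>x\<in>pverts G. \<forall>y\<in>pverts G. (f x, f y) \<in> parcs G \<longleftrightarrow> (x, y) \<in> parcs G)"

lemma graph_aut_closed: "graph_aut G f \<Longrightarrow> x \<in> pverts G \<Longrightarrow> f x \<in> pverts G"
  by (auto simp: graph_aut_def bij_betw_def)

lemma graph_aut_eq_iff:
  "graph_aut G f \<Longrightarrow> x \<in> pverts G \<Longrightarrow> y \<in> pverts G \<Longrightarrow> f x = f y \<longleftrightarrow> x = y"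
  by (auto simp: graph_aut_def bij_betw_def dest: inj_onD)

lemma graph_aut_arc_iff:
  "graph_aut G f \<Longrightarrow> x \<in> pverts G \<Longrightarrow> y \<in> pverts G \<Longrightarrow>
    (f x, f y) \<in> parcs G \<longleftrightarrow> (x, y) \<in> parcs G"
  by (auto simp: graph_aut_def)

lemma graph_aut_surj:
  assumes "graph_aut G f" "y \<in> pverts G"
  obtains x where "x \<in> pverts G" "y = f x"
proof -
  have "y \<in> f ` pverts G" using assms by (simp add: graph_aut_def bij_betw_def)
  then show ?thesis using that by blast
qed

text \<open>Invariance of a relation will be assumed as an implication only. Applied to the inverse
  automorphism it gives the converse, so that automorphisms map classes onto classes.\<close>

lemma graph_aut_inv_into:
  assumes "graph_aut G f"
  shows "graph_aut G (inv_into (pverts G) f)"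
proof -
  have bij: "bij_betw f (pverts G) (pverts G)"
    using assms by (simp add: graph_aut_def)
  have inv: "bij_betw (inv_into (pverts G) f) (pverts G) (pverts G)"
    using bij by (rule bij_betw_inv_into)
  show ?thesis
    unfolding graph_aut_def
  proof (intro conjI ballI)
    fix x y assume V: "x \<in> pverts G" "y \<in> pverts G"
    have "inv_into (pverts G) f x \<in> pverts G" "inv_into (pverts G) f y \<in> pverts G"
      using inv V by (auto simp: bij_betw_def)
    then show "(inv_into (pverts G) f x, inv_into (pverts G) f y) \<in> parcs G \<longleftrightarrow> (x, y) \<in> parcs G"
      using graph_aut_arc_iff[OF assms] V by (metis bij_betw_inv_into_right[OF bij])
  qed (rule inv)
qed

text \<open>The group elements are only known to preserve adjacency. They also reflect it, because
  the inverse group element preserves it too and undoes the permutation.\<close>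

lemma vertex_transitive_graph_aut:
  assumes "vertex_transitive G" "x \<in> pverts G" "y \<in> pverts G"
  obtains f where "graph_aut G f" "f x = y"
proof -
  obtain K :: "('a \<Rightarrow> 'a) monoid" and \<phi> where act: "transitive_action K (pverts G) \<phi>"
    and pres: "\<And>g x y. g \<in> carrier K \<Longrightarrow> (x, y) \<in> parcs G \<Longrightarrow> (\<phi> g x, \<phi> g y) \<in> parcs G"
    using assms(1) unfolding vertex_transitive_def by blast
  interpret transitive_action K "pverts G" \<phi> by fact
  interpret K: group K using group_hom by (simp add: group_hom_def)
  obtain g where g: "g \<in> carrier K" "\<phi> g x = y"
    using unique_orbit assms by blast
  have inv_act: "\<phi> (inv\<^bsub>K\<^esub> g) (\<phi> g u) = u" if "u \<in> pverts G" for u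
    using orbit_sym_aux[OF g(1) that refl] .
  have "graph_aut G (\<phi> g)"
    unfolding graph_aut_def
  proof (intro conjI ballI)
    show "bij_betw (\<phi> g) (pverts G) (pverts G)"
      using bij_prop0[OF g(1)] by (simp add: Bij_def)
    fix u v assume "u \<in> pverts G" "v \<in> pverts G"
    then show "(\<phi> g u, \<phi> g v) \<in> parcs G \<longleftrightarrow> (u, v) \<in> parcs G"
      using pres[OF g(1)] pres[of "inv\<^bsub>K\<^esub> g" "\<phi> g u" "\<phi> g v"] g(1) inv_act by auto
  qed
  with g show ?thesis by (intro that)
qed

lemma pair_graph_arc_sym:
  assumes "pair_graph G" "(x, y) \<in> parcs G"
  shows "(y, x) \<in> parcs G"
proof -
  interpret pair_graph G by fact
  show ?thesis using pair_sym_arcs assms(2) by (auto simp: symmetric_def sym_def)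
qed

lemma pair_graph_arc_verts:
  assumes "pair_graph G" "(x, y) \<in> parcs G"
  shows "x \<in> pverts G" "y \<in> pverts G" "x \<noteq> y"
proof -
  interpret pair_graph G by fact
  show "x \<in> pverts G" "y \<in> pverts G" "x \<noteq> y"
    using in_arcsD1 in_arcsD2 pair_no_loops assms(2) by fastforce+
qed

text \<open>This makes the relations "same open neighbourhood" and "same closed neighbourhood"
  invariant under automorphisms.\<close>

lemma graph_aut_image_neighbours:
  assumes G: "pair_graph G" and f: "graph_aut G f" and x: "x \<in> pverts G"
  shows "parcs G `` {f x} = f ` (parcs G `` {x})"
proof (intro equalityI subsetI)
  fix y assume y: "y \<in> parcs G `` {f x}"
  then have "y \<in> pverts G" using pair_graph_arc_verts(2)[OF G] by blast
  then obtain z where "z \<in> pverts G" "y = f z" using graph_aut_surj[OF f] by blast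
  then show "y \<in> f ` (parcs G `` {x})" using y graph_aut_arc_iff[OF f x] by auto
next
  fix y assume "y \<in> f ` (parcs G `` {x})"
  then show "y \<in> parcs G `` {f x}"
    using graph_aut_arc_iff[OF f x] pair_graph_arc_verts(2)[OF G] by auto
qed

section \<open>Wreath decomposition from an invariant equivalence relation\<close>

lemma pair_graphI:
  assumes "finite (pverts G)"
    and "\<And>x y. (x, y) \<in> parcs G \<Longrightarrow> x \<in> pverts G \<and> y \<in> pverts G \<and> x \<noteq> y \<and> (y, x) \<in> parcs G"
  shows "pair_graph G"
proof -
  have "parcs G \<subseteq> pverts G \<times> pverts G"
    using assms(2) by auto
  then have "finite (parcs G)"
    using assms(1) by (auto intro: finite_subset)
  then show ?thesis
    by unfold_locales (use assms in \<open>fastforce simp: symmetric_def sym_def\<close>)+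
qed

lemma digraph_iso_with_projI:
  assumes G: "pair_graph G" and D: "pair_graph D"
    and bij: "bij_betw f (pverts G) (pverts D)"
    and arcs: "\<And>x y. x \<in> pverts G \<Longrightarrow> y \<in> pverts G \<Longrightarrow>
      (f x, f y) \<in> parcs D \<longleftrightarrow> (x, y) \<in> parcs G"
  shows "digraph_iso (with_proj G) (with_proj D)"
proof -
  interpret pair_graph G by fact
  have "parcs D = map_prod f f ` parcs G"
  proof (intro equalityI subrelI)
    fix u v assume uv: "(u, v) \<in> parcs D"
    then have "u \<in> f ` pverts G" "v \<in> f ` pverts G"
      using bij pair_graph_arc_verts[OF D uv] by (simp_all add: bij_betw_def)
    with uv arcs show "(u, v) \<in> map_prod f f ` parcs G" by force
  next
    fix u v assume "(u, v) \<in> map_prod f f ` parcs G"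
    then show "(u, v) \<in> parcs D"
      using arcs pair_graph_arc_verts[OF G] by auto
  qed
  with bij show ?thesis
    using digraph_iso_with_proj_iff[OF pair_wf_digraph_axioms] by blast
qed

text \<open>By \<open>hom\<close>, adjacency between vertices of different classes depends on the
  classes alone, which is the outer factor. Within a class, an automorphism carries the induced
  graph onto that of one fixed class, which is the inner factor.\<close>

lemma iso_nontrivial_wreath_product_of_equiv:
  fixes G :: "'a pair_pre_digraph"
  assumes G: "pair_graph G" and trans: "vertex_transitive G"
    and equiv: "equiv (pverts G) R"
    and inv: "\<And>f x y. graph_aut G f \<Longrightarrow> (x, y) \<in> R \<Longrightarrow> (f x, f y) \<in> R"
    and hom: "\<And>x y z. (x, y) \<in> R \<Longrightarrow> (x, z) \<notin> R \<Longrightarrow> (x, z) \<in> parcs G \<Longrightarrow> (y, z) \<in> parcs G"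
    and nontriv: "(a, b) \<in> R" "a \<noteq> b"
    and proper: "c \<in> pverts G" "d \<in> pverts G" "(c, d) \<notin> R"
  shows "iso_nontrivial_wreath_product G"
proof -
  interpret pair_graph G by fact
  let ?V = "pverts G" and ?P = "pverts G // R"
  have RV: "x \<in> ?V" "y \<in> ?V" if "(x, y) \<in> R" for x y
    using equiv that by (auto simp: equiv_def)
  have Rrefl: "(x, x) \<in> R" if "x \<in> ?V" for x
    using equiv that by (auto simp: equiv_def refl_on_def)
  have Rsym: "(y, x) \<in> R" if "(x, y) \<in> R" for x y
    using equiv that by (auto simp: equiv_def sym_def)
  have Rtrans: "(x, z) \<in> R" if "(x, y) \<in> R" "(y, z) \<in> R" for x y z
    using equiv that by (auto simp: equiv_def elim: transE)
  have cls_eq: "R `` {x} = R `` {y} \<longleftrightarrow> (x, y) \<in> R" if "x \<in> ?V" "y \<in> ?V" for x y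
    using equiv that by (simp add: eq_equiv_class_iff)
  define B0 where "B0 = R `` {a}"
  have aV: "a \<in> ?V" using RV nontriv by blast
  have B0V: "B0 \<subseteq> ?V" using RV by (auto simp: B0_def)
  \<comment> \<open>An automorphism taking a vertex of \<open>C\<close> to \<open>a\<close> maps
    \<open>C\<close> into \<open>B0\<close> by invariance, and onto \<open>B0\<close> by invariance
    under its inverse.\<close>
  have "\<exists>f. graph_aut G f \<and> f ` C = B0" if C: "C \<in> ?P" for C
  proof -
    obtain x where x: "x \<in> ?V" "C = R `` {x}"
      using C by (auto elim: quotientE)
    obtain f where f: "graph_aut G f" "f x = a"
      using vertex_transitive_graph_aut[OF trans x(1) aV] .
    have "y \<in> f ` C" if y: "(a, y) \<in> R" for y
    proof -
      obtain z where z: "z \<in> ?V" "y = f z"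
        using graph_aut_surj[OF f(1) RV(2)[OF y]] .
      have "inv_into ?V f (f u) = u" if "u \<in> ?V" for u
        using f(1) that by (intro inv_into_f_f) (auto simp: graph_aut_def bij_betw_def)
      then have "(x, z) \<in> R"
        using inv[OF graph_aut_inv_into[OF f(1)] y] f(2) x(1) z by auto
      then show ?thesis using x z by blast
    qed
    moreover have "(a, f y) \<in> R" if "y \<in> C" for y
      using inv[OF f(1)] f(2) that x by blast
    ultimately have "f ` C = B0" by (auto simp: B0_def)
    with f show ?thesis by blast
  qed
  \<comment> \<open>The choice is made per class, not per vertex, so that two vertices of one class
    are moved by the same automorphism.\<close>
  then obtain g where g: "\<And>C. C \<in> ?P \<Longrightarrow> graph_aut G (g C)" "\<And>C. C \<in> ?P \<Longrightarrow> g C ` C = B0"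
    by metis
  \<comment> \<open>\<open>A\<close> is the quotient graph; pairs inside \<open>R\<close> are left
    out to avoid loops. One arc between two classes is enough to join them, since by
    \<open>A_arc\<close> all arcs between them are then present.\<close>
  define A where "A = \<lparr>pverts = ?P,
    parcs = {(R `` {x}, R `` {y}) | x y. (x, y) \<in> parcs G \<and> (x, y) \<notin> R}\<rparr>"
  define B where "B = \<lparr>pverts = B0, parcs = parcs G \<inter> B0 \<times> B0\<rparr>"
  define h where "h x = (R `` {x}, g (R `` {x}) x)" for x
  have A: "pair_graph A"
  proof (rule pair_graphI)
    show "finite (pverts A)"
      using equiv by (simp add: A_def finite_quotient equiv_type)
    fix C D assume "(C, D) \<in> parcs A"
    then obtain x y where xy: "C = R `` {x}" "D = R `` {y}" "(x, y) \<in> parcs G" "(x, y) \<notin> R"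
      by (auto simp: A_def)
    then have V: "x \<in> ?V" "y \<in> ?V" using pair_graph_arc_verts[OF G] by auto
    have "(D, C) \<in> parcs A"
      using xy pair_graph_arc_sym[OF G] Rsym by (auto simp: A_def)
    then show "C \<in> pverts A \<and> D \<in> pverts A \<and> C \<noteq> D \<and> (D, C) \<in> parcs A"
      using xy V cls_eq by (auto simp: A_def quotientI)
  qed
  have B: "pair_graph B"
    by (rule pair_graphI)
      (use B0V in \<open>auto simp: B_def intro: finite_subset dest: pair_graph_arc_verts[OF G]
        pair_graph_arc_sym[OF G]\<close>)
  \<comment> \<open>An arc between representatives is moved one end at a time: \<open>hom\<close>
    replaces \<open>x'\<close> by \<open>x\<close>, and after reversing the arc it replaces
    \<open>y'\<close> by \<open>y\<close>.\<close>
  have A_arc: "(R `` {x}, R `` {y}) \<in> parcs A \<longleftrightarrow> (x, y) \<in> parcs G \<and> (x, y) \<notin> R"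
    if V: "x \<in> ?V" "y \<in> ?V" for x y
  proof
    assume "(R `` {x}, R `` {y}) \<in> parcs A"
    then obtain x' y' where eq: "R `` {x} = R `` {x'}" "R `` {y} = R `` {y'}"
      and E: "(x', y') \<in> parcs G" "(x', y') \<notin> R"
      by (auto simp: A_def)
    have xx: "(x', x) \<in> R" and yy: "(y', y) \<in> R"
      using eq V cls_eq pair_graph_arc_verts[OF G E(1)] by metis+
    have "(x, y') \<in> parcs G" using hom[OF xx E(2) E(1)] .
    moreover have "(y', x) \<notin> R" using xx E(2) Rsym Rtrans by blast
    ultimately have "(y, x) \<in> parcs G"
      using hom[OF yy] pair_graph_arc_sym[OF G] by blast
    then show "(x, y) \<in> parcs G \<and> (x, y) \<notin> R"
      using pair_graph_arc_sym[OF G] xx yy E(2) Rsym Rtrans by blast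
  qed (auto simp: A_def)
  have P: "R `` {x} \<in> ?P" if "x \<in> ?V" for x
    using that by (rule quotientI)
  have gB: "g (R `` {x}) y \<in> B0" if "(x, y) \<in> R" for x y
    using g(2)[OF P[OF RV(1)[OF that]]] that by blast
  have bij: "bij_betw h ?V (pverts (wreath_product A B))"
    unfolding bij_betw_def
  proof
    show "inj_on h ?V"
    proof (rule inj_onI)
      fix x y assume V: "x \<in> ?V" "y \<in> ?V" and "h x = h y"
      then have "g (R `` {x}) x = g (R `` {x}) y" by (metis h_def prod.inject)
      then show "x = y" using graph_aut_eq_iff[OF g(1)[OF P[OF V(1)]] V] by simp
    qed
    show "h ` ?V = pverts (wreath_product A B)"
    proof (intro equalityI subsetI)
      fix u assume "u \<in> h ` ?V"
      then show "u \<in> pverts (wreath_product A B)"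
        using P gB Rrefl by (auto simp: h_def wreath_product_def A_def B_def)
    next
      fix u assume "u \<in> pverts (wreath_product A B)"
      then obtain C y where u: "u = (C, y)" "C \<in> ?P" "y \<in> B0"
        by (auto simp: wreath_product_def A_def B_def)
      then obtain x where x: "x \<in> C" "y = g C x" using g(2) by blast
      obtain z where z: "z \<in> ?V" "C = R `` {z}" using u(2) by (rule quotientE)
      have zx: "(z, x) \<in> R" using x(1) unfolding z(2) by simp
      have "x \<in> ?V" using RV(2)[OF zx] .
      moreover have "C = R `` {x}" using cls_eq[OF z(1) RV(2)[OF zx]] zx z(2) by simp
      ultimately show "u \<in> h ` ?V" using u(1) x(2) by (auto simp: h_def)
    qed
  qed
  have "digraph_iso (with_proj G) (with_proj (wreath_product A B))"
  proof (rule digraph_iso_with_projI[OF G pair_graph_wreath_product[OF A B] bij])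
    fix x y assume V: "x \<in> ?V" "y \<in> ?V"
    then have mem: "h x \<in> pverts A \<times> pverts B" "h y \<in> pverts A \<times> pverts B"
      using bij by (auto simp: bij_betw_def wreath_product_def)
    show "(h x, h y) \<in> parcs (wreath_product A B) \<longleftrightarrow> (x, y) \<in> parcs G"
    \<comment> \<open>In one class the first coordinates agree and \<open>A\<close> has no loop, so
      only \<open>B\<close> decides, and \<open>g\<close> respects adjacency. In different classes
      the first coordinates differ, so only \<open>A\<close> decides.\<close>
    proof (cases "(x, y) \<in> R")
      case True
      then have "R `` {x} = R `` {y}" using V cls_eq by blast
      then have hy: "h y = (R `` {x}, g (R `` {x}) y)" by (simp add: h_def)
      have "(R `` {x}, R `` {x}) \<notin> parcs A" using pair_graph_arc_verts(3)[OF A] by blast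
      moreover have "h x = (R `` {x}, g (R `` {x}) x)" by (simp add: h_def)
      ultimately show ?thesis
        using mem hy graph_aut_arc_iff[OF g(1)[OF P[OF V(1)]] V]
        by (simp add: wreath_product_def B_def)
    next
      case False
      then have "R `` {x} \<noteq> R `` {y}" using V cls_eq by blast
      then show ?thesis
        using mem A_arc[OF V] False by (simp add: wreath_product_def h_def)
    qed
  qed
  moreover have "2 \<le> card (pverts A)"
  proof -
    have "{R `` {c}, R `` {d}} \<subseteq> pverts A" using proper P by (auto simp: A_def)
    moreover have "card {R `` {c}, R `` {d}} = 2" using proper cls_eq by simp
    ultimately show ?thesis
      using card_mono pair_graph.axioms[OF A] A
      by (metis pair_fin_digraph.pair_finite_verts pair_graph_def pair_digraph_def)
  qed
  moreover have "2 \<le> card (pverts B)"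
  proof -
    have "{a, b} \<subseteq> B0" using nontriv aV Rrefl by (auto simp: B0_def)
    moreover have "finite B0" using B0V by (auto intro: finite_subset)
    ultimately have "card {a, b} \<le> card B0" by (intro card_mono)
    then show ?thesis using nontriv by (simp add: B_def)
  qed
  ultimately show ?thesis
    using iso_nontrivial_wreath_productI[OF G A B] by blast
qed

section \<open>Homogeneous sets\<close>

lemma homogeneousD:
  assumes "homogeneous G H" "x \<in> pverts G" "x \<notin> H" "h \<in> H" "h' \<in> H"
  shows "(x, h) \<in> parcs G \<longleftrightarrow> (x, h') \<in> parcs G"
  using assms unfolding homogeneous_def by blast

lemma homogeneousI:
  assumes "H \<noteq> {}" "H \<subseteq> pverts G"
    and "\<And>x h h'. x \<in> pverts G \<Longrightarrow> x \<notin> H \<Longrightarrow> h \<in> H \<Longrightarrow> h' \<in> H \<Longrightarrow> (x, h) \<in> parcs G \<Longrightarrow>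
      (x, h') \<in> parcs G"
  shows "homogeneous G H"
  using assms unfolding homogeneous_def by blast

lemma homogeneous_image:
  assumes H: "homogeneous G H" and f: "graph_aut G f"
  shows "homogeneous G (f ` H)"
proof (rule homogeneousI)
  have HV: "H \<subseteq> pverts G" using H by (simp add: homogeneous_def)
  show "f ` H \<noteq> {}" using H by (simp add: homogeneous_def)
  show "f ` H \<subseteq> pverts G" using HV graph_aut_closed[OF f] by blast
  fix x u v assume x: "x \<in> pverts G" "x \<notin> f ` H" and uv: "u \<in> f ` H" "v \<in> f ` H"
    and E: "(x, u) \<in> parcs G"
  obtain y where y: "y \<in> pverts G" "x = f y" using graph_aut_surj[OF f x(1)] .
  have "y \<notin> H" using x y(2) by blast
  moreover obtain p q where pq: "p \<in> H" "q \<in> H" "u = f p" "v = f q" using uv by blast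
  ultimately have "(y, p) \<in> parcs G \<longleftrightarrow> (y, q) \<in> parcs G"
    using homogeneousD[OF H y(1)] by blast
  moreover have "p \<in> pverts G" "q \<in> pverts G" using pq HV by auto
  ultimately show "(x, v) \<in> parcs G"
    using E graph_aut_arc_iff[OF f y(1)] y(2) pq by simp
qed

text \<open>A vertex outside the intersection is outside \<open>H\<close> or outside
  \<open>K\<close>, and homogeneity of that set settles the matter.\<close>

lemma homogeneous_Int:
  assumes "homogeneous G H" "homogeneous G K" "H \<inter> K \<noteq> {}"
  shows "homogeneous G (H \<inter> K)"
  using assms unfolding homogeneous_def by blast

text \<open>Only a vertex \<open>x\<close> of the intersection needs an argument. Take
  \<open>y\<close> in \<open>K - H\<close>: vertices of \<open>H - K\<close> lie outside
  \<open>K\<close>, so they do not distinguish \<open>x\<close> from \<open>y\<close>, and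
  \<open>y\<close> lies outside \<open>H\<close>, so it does not distinguish the vertices of
  \<open>H - K\<close>. Symmetry of adjacency joins the two facts.\<close>

lemma homogeneous_Diff:
  assumes G: "pair_graph G" and H: "homogeneous G H" and K: "homogeneous G K"
    and ne: "H - K \<noteq> {}" "K - H \<noteq> {}"
  shows "homogeneous G (H - K)"
proof (rule homogeneousI)
  have V: "H \<subseteq> pverts G" "K \<subseteq> pverts G" using H K by (auto simp: homogeneous_def)
  then show "H - K \<subseteq> pverts G" by blast
  fix x u v assume x: "x \<in> pverts G" "x \<notin> H - K" and uv: "u \<in> H - K" "v \<in> H - K"
    and E: "(x, u) \<in> parcs G"
  show "(x, v) \<in> parcs G"
  proof (cases "x \<in> H")
    case False
    then show ?thesis using homogeneousD[OF H x(1)] E uv by blast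
  next
    case True
    obtain y where y: "y \<in> K" "y \<notin> H" using ne by blast
    have sym: "(p, q) \<in> parcs G \<longleftrightarrow> (q, p) \<in> parcs G" for p q
      using pair_graph_arc_sym[OF G] by blast
    have "(w, x) \<in> parcs G \<longleftrightarrow> (y, w) \<in> parcs G" if "w \<in> H - K" for w
      using homogeneousD[OF K, of w x y] that True x y V sym[of w y] by blast
    moreover have "(y, u) \<in> parcs G \<longleftrightarrow> (y, v) \<in> parcs G"
      using homogeneousD[OF H, of y u v] y uv V by blast
    ultimately show ?thesis using E uv sym by blast
  qed
qed (use ne in blast)

lemma homogeneous_eq_if_minimal:
  assumes G: "pair_graph G" and H: "homogeneous G H" and K: "homogeneous G K"
    and card: "card H = k" "card K = k" "2 < k"
    and min: "\<And>L. homogeneous G L \<Longrightarrow> 2 \<le> card L \<Longrightarrow> k \<le> card L"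
    and meet: "H \<inter> K \<noteq> {}"
  shows "H = K"
proof (rule ccontr)
  assume neq: "H \<noteq> K"
  \<comment> \<open>Infinite sets have \<open>card\<close> 0, so \<open>2 < k\<close> forces
    finiteness.\<close>
  have fin: "finite H" "finite K" using card card_ge_0_finite by force+
  have "\<not> H \<subseteq> K" "\<not> K \<subseteq> H"
    using neq card fin card_subset_eq by metis+
  then have ne: "H - K \<noteq> {}" "K - H \<noteq> {}" by auto
  have sum: "card H = card (H \<inter> K) + card (H - K)"
    using fin(1) by (simp add: card_Diff_subset_Int card_mono)
  have pos: "0 < card (H \<inter> K)" "0 < card (H - K)"
    using fin meet ne by (auto simp: card_gt_0_iff)
  \<comment> \<open>Each of the two pieces of \<open>H\<close> is smaller than \<open>k\<close>
    because the other is non-empty, so \<open>min\<close> cannot apply to it and its size is below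
    2.\<close>
  have "card (H \<inter> K) < 2"
    using min[OF homogeneous_Int[OF H K meet]] sum pos card by linarith
  moreover have "card (H - K) < 2"
    using min[OF homogeneous_Diff[OF G H K ne]] sum pos card by linarith
  ultimately show False using sum card by linarith
qed

section \<open>Twins and homogeneous pairs\<close>

lemma iso_nontrivial_wreath_product_of_twins:
  assumes G: "pair_graph G" and trans: "vertex_transitive G" and nco: "\<not> cocomplete_graph G"
    and ab: "a \<in> pverts G" "b \<in> pverts G" "a \<noteq> b" "parcs G `` {a} = parcs G `` {b}"
  shows "iso_nontrivial_wreath_product G"
proof -
  let ?R = "{(x, y). x \<in> pverts G \<and> y \<in> pverts G \<and> parcs G `` {x} = parcs G `` {y}}"
  obtain c d where cd: "c \<in> pverts G" "d \<in> pverts G" "(c, d) \<in> parcs G"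
    using nco by (auto simp: cocomplete_graph_def)
  show ?thesis
  proof (rule iso_nontrivial_wreath_product_of_equiv[OF G trans, where R = ?R])
    show "equiv (pverts G) ?R" by (auto simp: equiv_def refl_on_def sym_def trans_def)
    show "(f x, f y) \<in> ?R" if f: "graph_aut G f" and R: "(x, y) \<in> ?R" for f x y
      using R graph_aut_image_neighbours[OF G f] graph_aut_closed[OF f] by simp
    show "(y, z) \<in> parcs G" if "(x, y) \<in> ?R" "(x, z) \<in> parcs G" for x y z
      using that by auto
    \<comment> \<open>Adjacent vertices never have equal open neighbourhoods, as this would give a
      loop at \<open>d\<close>; an adjacent pair exists because the graph is not cocomplete.\<close>
    show "(c, d) \<notin> ?R"
    proof
      assume "(c, d) \<in> ?R"
      then have "parcs G `` {c} = parcs G `` {d}" by simp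
      moreover have "d \<in> parcs G `` {c}" using cd by simp
      ultimately have "(d, d) \<in> parcs G" by simp
      then show False using pair_graph_arc_verts(3)[OF G] by blast
    qed
    show "(a, b) \<in> ?R" by (intro CollectI case_prodI conjI) (fact ab)+
  qed (fact ab cd)+
qed

text \<open>Dual to the previous case: distinct vertices with equal closed neighbourhoods are
  adjacent, so a non-adjacent pair, available because the graph is not complete, shows that the
  relation is not full.\<close>

lemma iso_nontrivial_wreath_product_of_closed_twins:
  assumes G: "pair_graph G" and trans: "vertex_transitive G" and nc: "\<not> complete_graph G"
    and ab: "a \<in> pverts G" "b \<in> pverts G" "a \<noteq> b"
      "insert a (parcs G `` {a}) = insert b (parcs G `` {b})"
  shows "iso_nontrivial_wreath_product G"
proof -
  let ?N = "\<lambda>x. insert x (parcs G `` {x})"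
  let ?R = "{(x, y). x \<in> pverts G \<and> y \<in> pverts G \<and> ?N x = ?N y}"
  obtain c d where cd: "c \<in> pverts G" "d \<in> pverts G" "c \<noteq> d" "(c, d) \<notin> parcs G"
    using nc by (auto simp: complete_graph_def)
  have im: "?N (f x) = f ` ?N x" if "graph_aut G f" "x \<in> pverts G" for f x
    using graph_aut_image_neighbours[OF G that] by simp
  show ?thesis
  proof (rule iso_nontrivial_wreath_product_of_equiv[OF G trans, where R = ?R])
    show "equiv (pverts G) ?R" by (auto simp: equiv_def refl_on_def sym_def trans_def)
    show "(f x, f y) \<in> ?R" if f: "graph_aut G f" and R: "(x, y) \<in> ?R" for f x y
    proof -
      have "?N (f x) = ?N (f y)" using R by (simp only: im[OF f] mem_Collect_eq prod.case)
      then show ?thesis using R graph_aut_closed[OF f] by auto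
    qed
    show "(y, z) \<in> parcs G" if R: "(x, y) \<in> ?R" and n: "(x, z) \<notin> ?R" and E: "(x, z) \<in> parcs G"
      for x y z
    proof -
      have "z \<noteq> y" using R n by auto
      moreover have "z \<in> ?N y" using R E by auto
      ultimately show ?thesis by simp
    qed
    show "(c, d) \<notin> ?R"
    proof
      assume "(c, d) \<in> ?R"
      then have "?N c = ?N d" by simp
      then have "d \<in> ?N c" by (simp only: insertI1)
      then show False using cd by simp
    qed
    show "(a, b) \<in> ?R" by (intro CollectI case_prodI conjI) (fact ab)+
  qed (fact ab cd)+
qed

text \<open>Every third vertex sees both elements of the pair or neither. Hence their closed
  neighbourhoods agree if the two are adjacent, and their open ones if they are not.\<close>

lemma homogeneous_pairE:
  assumes G: "pair_graph G" and H: "homogeneous G H" and card: "card H = 2"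
  obtains a b where "a \<in> pverts G" "b \<in> pverts G" "a \<noteq> b"
    "parcs G `` {a} = parcs G `` {b} \<or> insert a (parcs G `` {a}) = insert b (parcs G `` {b})"
proof -
  obtain a b where ab: "H = {a, b}" "a \<noteq> b" using card by (auto simp: card_2_iff)
  have V: "a \<in> pverts G" "b \<in> pverts G" using H ab by (auto simp: homogeneous_def)
  have sym: "(p, q) \<in> parcs G \<longleftrightarrow> (q, p) \<in> parcs G" for p q
    using pair_graph_arc_sym[OF G] by blast
  have noloop: "(x, x) \<notin> parcs G" for x using pair_graph_arc_verts(3)[OF G] by blast
  \<comment> \<open>Here \<open>z\<close> need not be a vertex; if it is not, both sides are
    false.\<close>
  have same: "(a, z) \<in> parcs G \<longleftrightarrow> (b, z) \<in> parcs G" if "z \<noteq> a" "z \<noteq> b" for z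
    using homogeneousD[OF H, of z a b] pair_graph_arc_verts[OF G] that ab sym by blast
  show ?thesis
  proof (cases "(a, b) \<in> parcs G")
    case True
    have "z \<in> insert a (parcs G `` {a}) \<longleftrightarrow> z \<in> insert b (parcs G `` {b})" for z
      using same[of z] True pair_graph_arc_sym[OF G True] by (cases "z = a"; cases "z = b") auto
    then have "insert a (parcs G `` {a}) = insert b (parcs G `` {b})" by (rule Set.set_eqI)
    then show ?thesis using that V ab by blast
  next
    case False
    then have "(a, z) \<in> parcs G \<longleftrightarrow> (b, z) \<in> parcs G" for z
      using same[of z] sym[of a b] noloop by (cases "z = a"; cases "z = b") auto
    then have "parcs G `` {a} = parcs G `` {b}" by blast
    then show ?thesis using that V ab by blast
  qed
qed

section \<open>The two directions of the equivalence\<close>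

lemma iso_nontrivial_wreath_product_if_not_prime:
  assumes G: "pair_graph G" and trans: "vertex_transitive G"
    and nc: "\<not> complete_graph G" and nco: "\<not> cocomplete_graph G"
    and np: "\<not> prime_graph G"
  shows "iso_nontrivial_wreath_product G"
proof -
  interpret pair_graph G by fact
  \<comment> \<open>The upper bound on the size is omitted, so that minimality compares with all
    homogeneous sets of size at least 2. A minimal \<open>H\<close> is still proper, being no larger
    than the proper set \<open>H1\<close>.\<close>
  define nt where "nt H \<longleftrightarrow> homogeneous G H \<and> 2 \<le> card H" for H
  obtain H1 where H1: "nt H1" "card H1 < card (pverts G)"
    using np by (auto simp: prime_graph_def nt_def)
  obtain H where H: "nt H" and least: "\<And>L. nt L \<Longrightarrow> card H \<le> card L"
    using ex_has_least_nat[of nt H1 card] H1(1) by blast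
  have Hhom: "homogeneous G H" and H2: "2 \<le> card H" using H by (auto simp: nt_def)
  have HV: "H \<subseteq> pverts G" and Hne: "H \<noteq> {}" using Hhom by (auto simp: homogeneous_def)
  have lt: "card H < card (pverts G)" using least[OF H1(1)] H1(2) by linarith
  show ?thesis
  proof (cases "card H = 2")
    case True
    then show ?thesis
      using homogeneous_pairE[OF G Hhom]
        iso_nontrivial_wreath_product_of_twins[OF G trans nco]
        iso_nontrivial_wreath_product_of_closed_twins[OF G trans nc] by metis
  next
    case False
    define P where "P = {L. homogeneous G L \<and> card L = card H}"
    have eq: "L = M" if "L \<in> P" "M \<in> P" "x \<in> L" "x \<in> M" for L M x
      using homogeneous_eq_if_minimal[OF G, of L M "card H"] that least False H2
      by (auto simp: P_def nt_def)
    have PV: "L \<subseteq> pverts G" if "L \<in> P" for L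
      using that by (auto simp: P_def homogeneous_def)
    have Pim: "f ` L \<in> P" if f: "graph_aut G f" and L: "L \<in> P" for f L
    proof -
      have "inj_on f L" using f PV[OF L] by (auto simp: graph_aut_def bij_betw_def intro: inj_on_subset)
      then show ?thesis using L homogeneous_image[OF _ f] by (auto simp: P_def card_image)
    qed
    have HP: "H \<in> P" using Hhom by (simp add: P_def)
    \<comment> \<open>By transitivity the translates of \<open>H\<close> under automorphisms reach
      every vertex, and they all belong to \<open>P\<close>.\<close>
    have cover: "\<exists>L\<in>P. x \<in> L" if x: "x \<in> pverts G" for x
    proof -
      obtain h where h: "h \<in> H" using Hne by blast
      then obtain f where "graph_aut G f" "f h = x"
        using vertex_transitive_graph_aut[OF trans subsetD[OF HV h] x] by blast
      then show ?thesis using Pim HP h by blast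
    qed
    let ?R = "{(x, y). \<exists>L\<in>P. x \<in> L \<and> y \<in> L}"
    obtain a b where ab: "a \<in> H" "b \<in> H" "a \<noteq> b"
      using H2 by (metis card_le_Suc0_iff_eq card.infinite not_numeral_le_zero not_less_eq_eq
        numeral_2_eq_2)
    obtain d where d: "d \<in> pverts G" "d \<notin> H"
      using lt HV by (metis less_irrefl subsetI subset_antisym)
    show ?thesis
    proof (rule iso_nontrivial_wreath_product_of_equiv[OF G trans, where R = ?R])
      \<comment> \<open>Two blocks that share the middle vertex coincide.\<close>
      have "trans ?R" unfolding trans_def using eq by blast
      then show "equiv (pverts G) ?R"
        using cover PV by (auto simp: equiv_def refl_on_def sym_def)
      show "(f x, f y) \<in> ?R" if "graph_aut G f" "(x, y) \<in> ?R" for f x y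
        using that Pim by blast
      show "(y, z) \<in> parcs G" if R: "(x, y) \<in> ?R" and n: "(x, z) \<notin> ?R" and E: "(x, z) \<in> parcs G"
        for x y z
      proof -
        obtain L where L: "L \<in> P" "x \<in> L" "y \<in> L" using R by blast
        then have "(z, x) \<in> parcs G \<longleftrightarrow> (z, y) \<in> parcs G"
          using homogeneousD[of G L z x y] n pair_graph_arc_verts[OF G E] by (auto simp: P_def)
        then show ?thesis using E pair_graph_arc_sym[OF G] by blast
      qed
      show "(a, d) \<notin> ?R" using eq HP ab d by blast
      show "(a, b) \<in> ?R" using HP ab by blast
    qed (use ab d HV in auto)
  qed
qed

text \<open>The witness is the preimage of a fibre \<open>{v} \<times> pverts B\<close>. It has
  \<open>card (pverts B)\<close> elements, at least 2, and is proper because \<open>A\<close> has at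
  least 2 vertices.\<close>

lemma not_prime_if_iso_nontrivial_wreath_product:
  assumes G: "pair_graph G" and iso: "iso_nontrivial_wreath_product G"
  shows "\<not> prime_graph G"
proof -
  interpret pair_graph G by fact
  obtain A B :: "nat pair_pre_digraph" where A: "pair_graph A" and B: "pair_graph B"
    and card: "2 \<le> card (pverts A)" "2 \<le> card (pverts B)"
    and AB: "digraph_iso (with_proj G) (with_proj (wreath_product A B))"
    using iso unfolding iso_nontrivial_wreath_product_def by blast
  obtain f where "bij_betw f (pverts G) (pverts (wreath_product A B))"
    and arcs: "parcs (wreath_product A B) = map_prod f f ` parcs G"
    using iffD1[OF digraph_iso_with_proj_iff[OF pair_wf_digraph_axioms] AB] by (elim exE conjE)
  then have bij: "bij_betw f (pverts G) (pverts A \<times> pverts B)"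
    by (simp add: wreath_product_def)
  \<comment> \<open>\<open>arcs\<close> only equates sets of arcs; injectivity of \<open>f\<close>
    on the vertices turns this into an equivalence for each pair.\<close>
  have arc: "(x, y) \<in> parcs G \<longleftrightarrow> (f x, f y) \<in> parcs (wreath_product A B)"
    if V: "x \<in> pverts G" "y \<in> pverts G" for x y
  proof
    assume "(f x, f y) \<in> parcs (wreath_product A B)"
    then obtain u w where uw: "(u, w) \<in> parcs G" "f x = f u" "f y = f w"
      by (auto simp: arcs)
    then have "x = u" "y = w"
      using V pair_graph_arc_verts[OF G uw(1)] bij by (auto simp: bij_betw_def dest: inj_onD)
    then show "(x, y) \<in> parcs G" using uw by simp
  qed (force simp: arcs)
  have fV: "f x \<in> pverts A \<times> pverts B" if "x \<in> pverts G" for x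
    using bij that by (rule bij_betwE[THEN bspec])
  obtain v where v: "v \<in> pverts A" using card(1) by fastforce
  define H where "H = {x \<in> pverts G. fst (f x) = v}"
  have fH: "f ` H = {v} \<times> pverts B"
  proof (intro equalityI subsetI)
    fix u assume "u \<in> f ` H"
    then show "u \<in> {v} \<times> pverts B" using fV by (auto simp: H_def mem_Times_iff)
  next
    fix u assume u: "u \<in> {v} \<times> pverts B"
    then have "u \<in> f ` pverts G" using bij v by (auto simp: bij_betw_def)
    then obtain x where "x \<in> pverts G" "u = f x" by blast
    with u show "u \<in> f ` H" by (auto simp: H_def mem_Times_iff)
  qed
  have "inj_on f H" using bij by (auto simp: H_def bij_betw_def intro: inj_on_subset)
  then have cH: "card H = card (pverts B)"
    using card_image[of f H] by (simp add: fH card_cartesian_product)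
  have cG: "card (pverts G) = card (pverts A) * card (pverts B)"
    using bij_betw_same_card[OF bij] by (simp add: card_cartesian_product)
  have "homogeneous G H"
  proof (rule homogeneousI)
    show "H \<noteq> {}" using cH card by auto
    show "H \<subseteq> pverts G" by (auto simp: H_def)
    fix x h h' assume x: "x \<in> pverts G" "x \<notin> H" and h: "h \<in> H" "h' \<in> H"
      and E: "(x, h) \<in> parcs G"
    have "f x \<in> pverts A \<times> pverts B" "f h' \<in> pverts A \<times> pverts B"
      using fV x h by (simp_all add: H_def)
    \<comment> \<open>The first coordinate of \<open>f x\<close> is not \<open>v\<close>, while
      those of \<open>f h\<close> and \<open>f h'\<close> are, so both adjacencies reduce to the
      same arc of \<open>A\<close>.\<close>
    then show "(x, h') \<in> parcs G"
      using arc[of x h] arc[of x h'] x h E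
      by (cases "f x"; cases "f h"; cases "f h'") (auto simp: H_def wreath_product_def)
  qed
  moreover have "card H < card (pverts G)"
    using cH cG card by simp
  moreover have "2 \<le> card H"
    using cH card(2) by simp
  ultimately show ?thesis
    unfolding prime_graph_def by blast
qed

theorem theorem3p2:
  fixes G :: "'a pair_pre_digraph"
  assumes "pair_graph G"
    and "vertex_transitive G"
    and "\<not> complete_graph G"
    and "\<not> cocomplete_graph G"
  shows "iso_nontrivial_wreath_product G \<longleftrightarrow> \<not> prime_graph G"
  using not_prime_if_iso_nontrivial_wreath_product[OF assms(1)]
    iso_nontrivial_wreath_product_if_not_prime[OF assms]
  by (rule iffI)

end
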